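(* Let $P,Q\in\mathcal{L}(n)$ with $\mathrm{atoms}(P)=\mathrm{atoms}(Q)$ (the same labeled atoms $1,\dots,n$). If $P$ covers $Q$ in $\mathcal{L}(n)$, then for every $T\in\mathcal{S}_P\setminus\mathcal{S}_Q$, the element $p\in P$ with $\mathrm{supp}(p)=T$ is meet-irreducible in $P$.
   Context: $\mathcal{L}(n)$ denotes the set of finite atomic lattices (finite lattices with bottom $0$ and top in which every nonzero element is a join of atoms) with $n$ atoms labeled $1,\dots,n$. For $P\in\mathcal{L}(n)$ and $p\in P$, $\mathrm{supp}(p)$ is the set of (labels of) atoms below $p$, and $\mathcal{S}_P=\{\mathrm{supp}(p):p\in P\}$, a family of subsets of $\{1,\dots,n\}$ which, ordered by inclusion, is isomorphic to $P$. $\mathcal{L}(n)$ is partially ordered by: $Q\le P$ iff there exists a join-preserving map from $P$ to $Q$ which is a bijection on atoms (respecting the labels); $P$ covers $Q$ means $Q<P$ and there is no $R$ with $Q<R<P$. An element $x$ of a lattice is meet-irreducible if $x\neq a\wedge b$ for all $a>x$, $b>x$. *)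

theory Defs
  imports "HOL-Algebra.Lattice"
begin

record 'a labeled_lattice = "'a gorder" +
  label :: "nat \<Rightarrow> 'a"

definition atoms :: "('a, 'b) gorder_scheme \<Rightarrow> 'a set" where
  "atoms L = {a \<in> carrier L. \<bottom>\<^bsub>L\<^esub> \<sqsubset>\<^bsub>L\<^esub> a \<and> \<not> (\<exists>x\<in>carrier L. \<bottom>\<^bsub>L\<^esub> \<sqsubset>\<^bsub>L\<^esub> x \<and> x \<sqsubset>\<^bsub>L\<^esub> a)}"

definition atomic_lattice :: "('a, 'b) gorder_scheme \<Rightarrow> bool" where
  "atomic_lattice L \<longleftrightarrow> bounded_lattice L \<and>
     (\<forall>x\<in>carrier L. x \<noteq> \<bottom>\<^bsub>L\<^esub> \<longrightarrow> (\<exists>A\<subseteq>atoms L. x = \<Squnion>\<^bsub>L\<^esub>A))"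

definition meet_irreducible :: "('a, 'b) gorder_scheme \<Rightarrow> 'a \<Rightarrow> bool" where
  "meet_irreducible L x \<longleftrightarrow> x \<in> carrier L \<and>
     (\<forall>a\<in>carrier L. \<forall>b\<in>carrier L. x \<sqsubset>\<^bsub>L\<^esub> a \<longrightarrow> x \<sqsubset>\<^bsub>L\<^esub> b \<longrightarrow> x \<noteq> a \<sqinter>\<^bsub>L\<^esub> b)"

text \<open>Only the values of \<^const>\<open>label\<close> on \<open>{1..n}\<close> are meaningful.\<close>

definition labeled_atomic_lattices :: "nat \<Rightarrow> 'a labeled_lattice set" where
  "labeled_atomic_lattices n =
     {P. atomic_lattice P \<and> finite (carrier P) \<and> bij_betw (label P) {1..n} (atoms P)}"

definition supp :: "nat \<Rightarrow> 'a labeled_lattice \<Rightarrow> 'a \<Rightarrow> nat set" where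
  "supp n P p = {i \<in> {1..n}. label P i \<sqsubseteq>\<^bsub>P\<^esub> p}"

definition supports :: "nat \<Rightarrow> 'a labeled_lattice \<Rightarrow> nat set set" where
  "supports n P = supp n P ` carrier P"

definition lat_le :: "nat \<Rightarrow> 'a labeled_lattice \<Rightarrow> 'a labeled_lattice \<Rightarrow> bool" where
  "lat_le n Q P \<longleftrightarrow>
     (\<exists>f \<in> carrier P \<rightarrow> carrier Q. join_pres P Q f \<and> bij_betw f (atoms P) (atoms Q) \<and>
        (\<forall>i\<in>{1..n}. f (label P i) = label Q i))"

text \<open>Label-preserving isomorphism, which is what equality of two elements of the set of labeled
  atomic lattices means.\<close>

definition lat_iso :: "nat \<Rightarrow> 'a labeled_lattice \<Rightarrow> 'a labeled_lattice \<Rightarrow> bool" where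
  "lat_iso n Q P \<longleftrightarrow>
     (\<exists>f. bij_betw f (carrier Q) (carrier P) \<and> order_emb Q P f \<and>
        (\<forall>i\<in>{1..n}. f (label Q i) = label P i))"

definition lat_less :: "nat \<Rightarrow> 'a labeled_lattice \<Rightarrow> 'a labeled_lattice \<Rightarrow> bool" where
  "lat_less n Q P \<longleftrightarrow> lat_le n Q P \<and> \<not> lat_iso n Q P"

text \<open>Restricting \<open>R\<close> below to carriers in the type \<open>'a\<close> of \<open>P\<close> excludes nothing: elements of
  \<open>R\<close> are joins of atoms, so if \<open>R \<le> P\<close> then \<open>R\<close> has at most as many elements as \<open>P\<close> and is
  isomorphic to a lattice with carrier in \<open>'a\<close>.\<close>

definition lat_covers :: "nat \<Rightarrow> 'a labeled_lattice \<Rightarrow> 'a labeled_lattice \<Rightarrow> bool" where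
  "lat_covers n P Q \<longleftrightarrow> lat_less n Q P \<and>
     \<not> (\<exists>R \<in> labeled_atomic_lattices n. lat_less n Q R \<and> lat_less n R P)"

end

theory Submission
  imports Defs
begin

text \<open>For labeled atomic lattices, \<open>Q \<le> P\<close> means that every support of \<open>Q\<close> is a support of \<open>P\<close>.
  If \<open>t\<close> is maximal among the elements of \<open>P\<close> whose support is missing in \<open>Q\<close>, then \<open>t\<close> is not the
  meet of two larger elements, since these have supports in \<open>Q\<close> and the supports of \<open>Q\<close> are closed
  under intersection. So deleting \<open>t\<close> from \<open>P\<close> leaves an atomic lattice \<open>R\<close> with \<open>Q \<le> R < P\<close>. As \<open>P\<close>
  covers \<open>Q\<close>, this forces \<open>R = Q\<close>, and \<open>t\<close> is the only element of \<open>P\<close> whose support is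
  missing in \<open>Q\<close>.\<close>

section \<open>Least and greatest elements of finite closed subsets\<close>

text \<open>The meet of all elements of \<open>A\<close> again lies in \<open>A\<close>. This
  supplies joins in suborders and, below, the values of a lower adjoint.\<close>

lemma (in lower_semilattice) meet_closed_has_least:
  assumes "finite A" "A \<noteq> {}" "A \<subseteq> carrier L"
    and meet: "\<And>x y. x \<in> A \<Longrightarrow> y \<in> A \<Longrightarrow> x \<sqinter> y \<in> A"
  obtains m where "least L m A"
proof -
  have "\<exists>m\<in>A. \<forall>x\<in>B. m \<sqsubseteq> x" if "finite B" "B \<noteq> {}" "B \<subseteq> A" for B
    using that
  proof (induction rule: finite_ne_induct)
    case (singleton x)
    then show ?case using assms(3) le_refl by blast
  next
    case (insert x B)
    then obtain m where m: "m \<in> A" "\<forall>x\<in>B. m \<sqsubseteq> x" by auto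
    have x: "x \<in> A" using insert.prems by simp
    have c: "x \<in> carrier L" "m \<in> carrier L" using assms(3) x m(1) by (simp_all add: subsetD)
    have "x \<sqinter> m \<sqsubseteq> y" if "y \<in> insert x B" for y
      using that
    proof
      assume "y = x"
      then show ?thesis using meet_left[OF c] by simp
    next
      assume y: "y \<in> B"
      then have "x \<sqinter> m \<sqsubseteq> m" "m \<sqsubseteq> y" using m(2) meet_right[OF c] by simp_all
      moreover have "x \<sqinter> m \<in> carrier L" "m \<in> carrier L" "y \<in> carrier L"
        using c y insert.prems assms(3) by auto
      ultimately show ?thesis by (rule le_trans)
    qed
    then show ?case using meet[OF x m(1)] by blast
  qed
  from this[OF assms(1,2) subset_refl] show thesis
    using that assms(3) unfolding least_def by blast
qed

lemma (in lattice) join_closed_has_greatest: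
  assumes "finite A" "A \<noteq> {}" "A \<subseteq> carrier L"
    and "\<And>x y. x \<in> A \<Longrightarrow> y \<in> A \<Longrightarrow> x \<squnion> y \<in> A"
  obtains m where "greatest L m A"
proof -
  interpret dual: lattice "inv_gorder L" by (rule dual_lattice)
  obtain m where "least (inv_gorder L) m A"
    using dual.meet_closed_has_least[of A] assms by auto
  then show thesis using that by simp
qed

section \<open>Supports in one labeled atomic lattice\<close>

text \<open>Membership in \<open>labeled_atomic_lattices n\<close> in locale form, so that
  \<open>P\<close> and \<open>Q\<close> can be interpreted side by side.\<close>

locale labeled_atomic_lattice = bounded_lattice P
  for n :: nat and P :: "'a labeled_lattice" (structure) +
  assumes finite_carrier: "finite (carrier P)"
    and bij_label: "bij_betw (label P) {1..n} (atoms P)"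
    and atomistic: "x \<in> carrier P \<Longrightarrow> x \<noteq> \<bottom> \<Longrightarrow> \<exists>A\<subseteq>atoms P. x = \<Squnion>A"

lemma mem_labeled_atomic_lattices:
  "P \<in> labeled_atomic_lattices n \<longleftrightarrow> labeled_atomic_lattice n P"
  by (auto simp: labeled_atomic_lattices_def atomic_lattice_def labeled_atomic_lattice_def
      labeled_atomic_lattice_axioms_def)

context labeled_atomic_lattice
begin

lemma atoms_eq: "atoms P = label P ` {1..n}"
  using bij_label by (simp add: bij_betw_def)

lemma label_atom: "i \<in> {1..n} \<Longrightarrow> label P i \<in> atoms P"
  by (simp add: atoms_eq)

lemma atoms_closed: "a \<in> atoms P \<Longrightarrow> a \<in> carrier P"
  by (simp add: atoms_def)

lemma label_closed: "i \<in> {1..n} \<Longrightarrow> label P i \<in> carrier P"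
  using label_atom atoms_closed by blast

lemma atom_not_bottom: "a \<in> atoms P \<Longrightarrow> a \<noteq> \<bottom>"
  by (auto simp: atoms_def lless_eq)

lemma atom_le_atom: "a \<in> atoms P \<Longrightarrow> b \<in> atoms P \<Longrightarrow> a \<sqsubseteq> b \<Longrightarrow> a = b"
  by (auto simp: atoms_def lless_eq)

lemma atom_le_bottom: "a \<in> atoms P \<Longrightarrow> \<not> a \<sqsubseteq> \<bottom>"
  using atom_not_bottom atoms_closed bottom_closed bottom_lower le_antisym by blast

lemma le_if_atoms_le:
  assumes "x \<in> carrier P" "y \<in> carrier P"
    and "\<And>a. a \<in> atoms P \<Longrightarrow> a \<sqsubseteq> x \<Longrightarrow> a \<sqsubseteq> y"
  shows "x \<sqsubseteq> y"
proof (cases "x = \<bottom>")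
  case True
  then show ?thesis using assms(2) by simp
next
  case False
  then obtain A where A: "A \<subseteq> atoms P" "x = \<Squnion>A" using atomistic assms(1) by blast
  \<comment> \<open>The join of the empty set is \<bottom>; \<open>finite_sup_least\<close> concerns
    nonempty sets.\<close>
  have "A \<noteq> {}"
  proof
    assume "A = {}"
    then have "x = \<bottom>" using A(2) by (simp add: sup_def bottom_def)
    with False show False by simp
  qed
  moreover have "A \<subseteq> carrier P" using A(1) atoms_closed by blast
  ultimately have "least P x (Upper P A)"
    using finite_sup_least finite_carrier finite_subset A(2) by metis
  then show ?thesis
    using A(1) assms(2,3) \<open>A \<subseteq> carrier P\<close>
    by (meson Upper_memI least_Upper_above least_le subsetD)
qed

text \<open>By atomicity an element is determined by the atoms below it, so \<open>supp n P\<close>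
  is an order embedding into the subsets of \<open>{1..n}\<close>.\<close>

lemma supp_subset_iff:
  "x \<in> carrier P \<Longrightarrow> y \<in> carrier P \<Longrightarrow> supp n P x \<subseteq> supp n P y \<longleftrightarrow> x \<sqsubseteq> y"
proof
  assume c: "x \<in> carrier P" "y \<in> carrier P" and sub: "supp n P x \<subseteq> supp n P y"
  show "x \<sqsubseteq> y"
  proof (rule le_if_atoms_le[OF c])
    fix a assume "a \<in> atoms P" "a \<sqsubseteq> x"
    then obtain i where "i \<in> supp n P x" "a = label P i" unfolding atoms_eq supp_def by blast
    then show "a \<sqsubseteq> y" using sub unfolding supp_def by blast
  qed
next
  assume "x \<in> carrier P" "y \<in> carrier P" "x \<sqsubseteq> y"
  then show "supp n P x \<subseteq> supp n P y"
    unfolding supp_def using le_trans[OF _ _ label_closed] by auto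
qed

lemma supp_inj: "inj_on (supp n P) (carrier P)"
  by (rule inj_onI) (metis le_antisym order_refl supp_subset_iff)

lemma supp_bottom: "supp n P \<bottom> = {}"
  using atom_le_bottom label_atom by (auto simp: supp_def)

lemma supp_top: "supp n P \<top> = {1..n}"
  using label_closed by (auto simp: supp_def)

lemma supp_label:
  assumes i: "i \<in> {1..n}"
  shows "supp n P (label P i) = {i}"
proof -
  have "j = i" if "j \<in> {1..n}" "label P j \<sqsubseteq> label P i" for j
    using atom_le_atom[OF label_atom[OF that(1)] label_atom[OF i] that(2)]
      inj_onD[OF bij_betw_imp_inj_on[OF bij_label]] that(1) i by blast
  then show ?thesis using i label_closed[OF i] by (auto simp: supp_def)
qed

lemma supp_meet:
  assumes "x \<in> carrier P" "y \<in> carrier P"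
  shows "supp n P (x \<sqinter> y) = supp n P x \<inter> supp n P y"
proof -
  have "z \<sqsubseteq> x \<sqinter> y \<longleftrightarrow> z \<sqsubseteq> x \<and> z \<sqsubseteq> y" if "z \<in> carrier P" for z
    using that assms by (meson le_trans meet_closed meet_le meet_left meet_right)
  then show ?thesis using label_closed by (auto simp: supp_def)
qed

text \<open>Applied to \<open>Q\<close>, this and the next three facts show that an element of
  \<open>P\<close> whose support is missing in \<open>Q\<close> is neither \<bottom>, \<top> nor an
  atom, and is not the meet of elements whose supports occur in \<open>Q\<close>.\<close>

lemma supports_bottom: "{} \<in> supports n P"
  unfolding supports_def using supp_bottom bottom_closed by (metis imageI)

lemma supports_top: "{1..n} \<in> supports n P"
  unfolding supports_def using supp_top top_closed by (metis imageI)

lemma supports_singleton: "i \<in> {1..n} \<Longrightarrow> {i} \<in> supports n P"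
  unfolding supports_def using supp_label label_closed by (metis imageI)

lemma supports_Int: "S \<in> supports n P \<Longrightarrow> T \<in> supports n P \<Longrightarrow> S \<inter> T \<in> supports n P"
  unfolding supports_def by clarify (metis imageI meet_closed supp_meet)

section \<open>Suborders closed under meets\<close>

text \<open>The join of \<open>P\<close> need not be the join of the suborder below.\<close>

lemma meet_closed_suborder:
  assumes C: "C \<subseteq> carrier P" "\<bottom> \<in> C" "\<top> \<in> C" "atoms P \<subseteq> C"
    and meet: "\<And>x y. x \<in> C \<Longrightarrow> y \<in> C \<Longrightarrow> x \<sqinter> y \<in> C"
  shows "P\<lparr>carrier := C\<rparr> \<in> labeled_atomic_lattices n"
proof -
  let ?R = "P\<lparr>carrier := C\<rparr>"
  have CD: "x \<in> carrier P" if "x \<in> C" for x using C(1) that by blast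
  interpret R: partial_order ?R
    by unfold_locales (auto simp: eq_is_equal CD intro: le_trans[OF _ _ CD CD CD] le_antisym)
  interpret R: bounded_lattice ?R
  proof
    fix x y assume "x \<in> carrier ?R" "y \<in> carrier ?R"
    then have xy: "x \<in> C" "y \<in> C" by auto
    show "\<exists>s. greatest ?R s (Lower ?R {x, y})"
      using xy meet CD meet_left meet_right meet_le
      by (intro exI[of _ "x \<sqinter> y"]) (auto simp: greatest_def Lower_def)
    \<comment> \<open>The join of \<open>x\<close> and \<open>y\<close> in the suborder is the least
      element of \<open>?U\<close>, which contains \<top> and is closed under meets.\<close>
    let ?U = "{z \<in> C. x \<sqsubseteq> z \<and> y \<sqsubseteq> z}"
    have "finite ?U" by (rule finite_subset[OF _ finite_carrier]) (use C(1) in auto)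
    moreover have "\<top> \<in> ?U" using C(3) xy CD by auto
    moreover have "?U \<subseteq> carrier P" using CD by blast
    moreover have "a \<sqinter> b \<in> ?U" if "a \<in> ?U" "b \<in> ?U" for a b
      using that meet meet_le xy CD by simp
    ultimately obtain m where "least P m ?U"
      using meet_closed_has_least[of ?U] by blast
    then show "\<exists>s. least ?R s (Upper ?R {x, y})"
      using xy by (intro exI[of _ m]) (auto simp: least_def Upper_def)
  next
    show "\<exists>x. least ?R x (carrier ?R)"
      using C(2) CD by (intro exI[of _ \<bottom>]) (auto simp: least_def)
    show "\<exists>x. greatest ?R x (carrier ?R)"
      using C(3) CD by (intro exI[of _ \<top>]) (auto simp: greatest_def)
  qed
  have bot: "\<bottom>\<^bsub>?R\<^esub> = \<bottom>"
    using C(2) CD R.bottom_eq[of \<bottom>] by simp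
  have less: "x \<sqsubset>\<^bsub>?R\<^esub> y \<longleftrightarrow> x \<sqsubset> y" for x y
    by (simp add: lless_def)
  have atoms: "atoms ?R = atoms P"
  proof
    show "atoms P \<subseteq> atoms ?R"
      using C(4) CD by (auto simp: atoms_def bot less)
    show "atoms ?R \<subseteq> atoms P"
    proof
      fix a assume a: "a \<in> atoms ?R"
      then have aC: "a \<in> C" "\<bottom> \<sqsubset> a" and
        min: "\<And>x. x \<in> C \<Longrightarrow> \<bottom> \<sqsubset> x \<Longrightarrow> \<not> x \<sqsubset> a"
        by (auto simp: atoms_def bot less)
      \<comment> \<open>Since \<open>a\<close> is not below \<bottom>, some atom \<open>b\<close> of
        \<open>P\<close> lies below \<open>a\<close>. As \<open>b\<close> belongs to
        \<open>C\<close>, minimality of \<open>a\<close> there gives \<open>b = a\<close>.\<close>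
      have "\<not> a \<sqsubseteq> \<bottom>" using aC CD le_antisym by (auto simp: lless_eq)
      then obtain b where b: "b \<in> atoms P" "b \<sqsubseteq> a"
        using le_if_atoms_le[of a \<bottom>] aC(1) CD by auto
      then have "\<bottom> \<sqsubset> b" by (simp add: atoms_def)
      then have "b = a" using min[of b] b C(4) by (auto simp: lless_eq)
      then show "a \<in> atoms P" using b by simp
    qed
  qed
  have "labeled_atomic_lattice n ?R"
  proof
    show "finite (carrier ?R)" using finite_subset[OF C(1) finite_carrier] by simp
    show "bij_betw (label ?R) {1..n} (atoms ?R)" using bij_label by (simp add: atoms)
    fix x assume "x \<in> carrier ?R" "x \<noteq> \<bottom>\<^bsub>?R\<^esub>"
    then have x: "x \<in> C" "x \<noteq> \<bottom>" by (auto simp: bot)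
    \<comment> \<open>All atoms below \<open>x\<close>: any upper bound of them in \<open>C\<close>
      is above \<open>x\<close> already in \<open>P\<close>, by
      \<open>le_if_atoms_le\<close>.\<close>
    let ?A = "{a \<in> atoms P. a \<sqsubseteq> x}"
    have lub: "least ?R x (Upper ?R ?A)"
    proof (rule least_UpperI)
      fix y assume y: "y \<in> Upper ?R ?A"
      then have "y \<in> C" by (auto simp: Upper_def)
      moreover have "a \<sqsubseteq> y" if "a \<in> atoms P" "a \<sqsubseteq> x" for a
        using y that C(4) by (auto simp: Upper_def)
      ultimately show "x \<sqsubseteq>\<^bsub>?R\<^esub> y" using le_if_atoms_le x CD by simp
    qed (use x C(4) in auto)
    have "x = \<Squnion>\<^bsub>?R\<^esub>?A"
      unfolding sup_def using lub R.least_unique by (metis (mono_tags, lifting) someI)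
    then show "\<exists>A\<subseteq>atoms ?R. x = \<Squnion>\<^bsub>?R\<^esub>A"
      by (intro exI[of _ ?A] conjI) (simp_all only: atoms, blast)
  qed
  then show ?thesis by (simp add: mem_labeled_atomic_lattices)
qed

end

section \<open>The order of labeled lattices in terms of supports\<close>

text \<open>A join-preserving \<open>f\<close> has an upper adjoint: the largest \<open>p\<close>
  with \<open>f p\<close> below \<open>q\<close> has the same support as \<open>q\<close>.\<close>

lemma supports_mono_if_lat_le:
  assumes "P \<in> labeled_atomic_lattices n" "Q \<in> labeled_atomic_lattices n" "lat_le n Q P"
  shows "supports n Q \<subseteq> supports n P"
proof
  interpret P: labeled_atomic_lattice n P using assms by (simp add: mem_labeled_atomic_lattices)
  interpret Q: labeled_atomic_lattice n Q using assms by (simp add: mem_labeled_atomic_lattices)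
  obtain f where f: "f \<in> carrier P \<rightarrow> carrier Q" "join_pres P Q f"
    and lab: "\<And>i. i \<in> {1..n} \<Longrightarrow> f (label P i) = label Q i"
    using assms(3) by (auto simp: lat_le_def)
  have fc: "f x \<in> carrier Q" if "x \<in> carrier P" for x using f(1) that by blast
  have join: "f (x \<squnion>\<^bsub>P\<^esub> y) = f x \<squnion>\<^bsub>Q\<^esub> f y" if "x \<in> carrier P" "y \<in> carrier P" for x y
    using f(2) that by (simp add: join_pres_def)
  have mono: "f x \<sqsubseteq>\<^bsub>Q\<^esub> f y" if "x \<in> carrier P" "y \<in> carrier P" "x \<sqsubseteq>\<^bsub>P\<^esub> y" for x y
    using join_pres_isotone[OF f] that by (simp add: isotone_def)
  fix T assume "T \<in> supports n Q"
  then obtain q where q: "q \<in> carrier Q" "T = supp n Q q" by (auto simp: supports_def)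
  let ?F = "{x \<in> carrier P. f x \<sqsubseteq>\<^bsub>Q\<^esub> q}"
  show "T \<in> supports n P"
  \<comment> \<open>\<open>join_pres\<close> speaks of binary joins only, so \<open>f\<close> need
    not send \<bottom> to \<bottom>. For \<open>n = 1\<close> it may send everything to the atom,
    and \<open>?F\<close> is then empty for \<open>q\<close> equal to \<bottom>.\<close>
  proof (cases "?F = {}")
    case True
    have "\<not> label Q i \<sqsubseteq>\<^bsub>Q\<^esub> q" if "i \<in> {1..n}" for i
      using True P.label_closed[OF that] lab[OF that] by force
    then have "T = {}" using q by (auto simp: supp_def)
    then show ?thesis using P.supports_bottom by simp
  next
    case False
    obtain p where p: "greatest P p ?F"
      using P.join_closed_has_greatest[of ?F] P.finite_carrier False join Q.join_le fc q(1) by auto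
    then have pc: "p \<in> carrier P" "f p \<sqsubseteq>\<^bsub>Q\<^esub> q" by (auto simp: greatest_def)
    have "label P i \<sqsubseteq>\<^bsub>P\<^esub> p \<longleftrightarrow> label Q i \<sqsubseteq>\<^bsub>Q\<^esub> q" if i: "i \<in> {1..n}" for i
    proof
      assume "label P i \<sqsubseteq>\<^bsub>P\<^esub> p"
      then have "label Q i \<sqsubseteq>\<^bsub>Q\<^esub> f p" using mono[of "label P i" p] pc(1) i P.label_closed lab by simp
      then show "label Q i \<sqsubseteq>\<^bsub>Q\<^esub> q" using pc q(1) fc Q.label_closed i Q.le_trans by blast
    next
      assume "label Q i \<sqsubseteq>\<^bsub>Q\<^esub> q"
      then show "label P i \<sqsubseteq>\<^bsub>P\<^esub> p" using p i P.label_closed lab by (auto simp: greatest_def)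
    qed
    then have "T = supp n P p" using q(2) by (auto simp: supp_def)
    then show ?thesis using pc(1) by (simp add: supports_def)
  qed
qed

text \<open>The required map sends \<open>x\<close> to the least element of \<open>Q\<close> whose
  support contains that of \<open>x\<close>. It is lower adjoint to the inclusion of supports and
  therefore preserves joins.\<close>

lemma lat_le_if_supports_mono:
  assumes "P \<in> labeled_atomic_lattices n" "Q \<in> labeled_atomic_lattices n"
    and sub: "supports n Q \<subseteq> supports n P"
  shows "lat_le n Q P"
proof -
  interpret P: labeled_atomic_lattice n P using assms by (simp add: mem_labeled_atomic_lattices)
  interpret Q: labeled_atomic_lattice n Q using assms by (simp add: mem_labeled_atomic_lattices)
  have "\<exists>m. least Q m {q \<in> carrier Q. supp n P x \<subseteq> supp n Q q}" (is "\<exists>m. least Q m ?A") for x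
  proof -
    have "supp n P x \<subseteq> {1..n}" by (auto simp: supp_def)
    then have "\<top>\<^bsub>Q\<^esub> \<in> ?A" using Q.top_closed by (simp add: Q.supp_top)
    moreover have "finite ?A" "?A \<subseteq> carrier Q" using Q.finite_carrier by auto
    moreover have "a \<sqinter>\<^bsub>Q\<^esub> b \<in> ?A" if "a \<in> ?A" "b \<in> ?A" for a b
      using that by (simp add: Q.supp_meet)
    ultimately show ?thesis using Q.meet_closed_has_least[of ?A] by blast
  qed
  then have "\<forall>x. \<exists>m. least Q m {q \<in> carrier Q. supp n P x \<subseteq> supp n Q q}" by (rule allI)
  from choice[OF this] obtain f
    where f: "\<And>x. least Q (f x) {q \<in> carrier Q. supp n P x \<subseteq> supp n Q q}"
    by blast
  have fc: "f x \<in> carrier Q" if "x \<in> carrier P" for x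
    using f[of x] by (simp add: least_def)
  have adj: "f x \<sqsubseteq>\<^bsub>Q\<^esub> q \<longleftrightarrow> supp n P x \<subseteq> supp n Q q" if "x \<in> carrier P" "q \<in> carrier Q" for x q
    using f[of x] that(2) fc[OF that(1)] Q.supp_subset_iff[of "f x" q]
    by (auto simp: least_def)
  \<comment> \<open>Both sides of the join equation have the same upper bounds \<open>q\<close>.
    Here \<open>sub\<close> enters: the support of \<open>q\<close> is that of some \<open>p\<close>
    in \<open>P\<close>, which turns the claim into the universal property of the join in
    \<open>P\<close>.\<close>
  have join_iff: "f (x \<squnion>\<^bsub>P\<^esub> y) \<sqsubseteq>\<^bsub>Q\<^esub> q \<longleftrightarrow> f x \<sqsubseteq>\<^bsub>Q\<^esub> q \<and> f y \<sqsubseteq>\<^bsub>Q\<^esub> q"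
    if xy: "x \<in> carrier P" "y \<in> carrier P" and q: "q \<in> carrier Q" for x y q
  proof -
    obtain p where p: "p \<in> carrier P" "supp n Q q = supp n P p"
      using sub q by (auto simp: supports_def)
    have "x \<squnion>\<^bsub>P\<^esub> y \<sqsubseteq>\<^bsub>P\<^esub> p \<longleftrightarrow> x \<sqsubseteq>\<^bsub>P\<^esub> p \<and> y \<sqsubseteq>\<^bsub>P\<^esub> p"
      using xy p(1) by (meson P.join_closed P.join_le P.join_left P.join_right P.le_trans)
    then show ?thesis using xy q p by (simp add: adj P.supp_subset_iff)
  qed
  have "f (x \<squnion>\<^bsub>P\<^esub> y) = f x \<squnion>\<^bsub>Q\<^esub> f y" if xy: "x \<in> carrier P" "y \<in> carrier P" for x y
  proof (rule Q.le_antisym)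
    have c: "f x \<in> carrier Q" "f y \<in> carrier Q" "f (x \<squnion>\<^bsub>P\<^esub> y) \<in> carrier Q"
      using fc xy by simp_all
    show "f (x \<squnion>\<^bsub>P\<^esub> y) \<sqsubseteq>\<^bsub>Q\<^esub> f x \<squnion>\<^bsub>Q\<^esub> f y"
      using join_iff[OF xy] c Q.join_left Q.join_right by simp
    show "f x \<squnion>\<^bsub>Q\<^esub> f y \<sqsubseteq>\<^bsub>Q\<^esub> f (x \<squnion>\<^bsub>P\<^esub> y)"
      using join_iff[OF xy c(3)] c Q.join_le by simp
  qed (use fc xy in simp_all)
  then have "join_pres P Q f"
    using P.lattice_axioms Q.lattice_axioms by (simp add: join_pres_def)
  moreover have lab: "f (label P i) = label Q i" if i: "i \<in> {1..n}" for i
  proof (rule Q.le_antisym)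
    have c: "label P i \<in> carrier P" "label Q i \<in> carrier Q" "f (label P i) \<in> carrier Q"
      using fc P.label_closed Q.label_closed i by auto
    show "f (label P i) \<sqsubseteq>\<^bsub>Q\<^esub> label Q i"
      using adj[OF c(1,2)] P.supp_label[OF i] Q.supp_label[OF i] by simp
    show "label Q i \<sqsubseteq>\<^bsub>Q\<^esub> f (label P i)"
      using adj[OF c(1,3)] c Q.supp_subset_iff[OF c(2,3)] P.supp_label[OF i] Q.supp_label[OF i]
      by simp
  qed (use fc P.label_closed Q.label_closed i in auto)
  moreover have "bij_betw f (atoms P) (atoms Q)"
  proof -
    \<comment> \<open>On \<open>{1..n}\<close> this composition is \<open>label Q\<close>;
      cancelling the bijection \<open>label P\<close> leaves \<open>f\<close> on atoms.\<close>
    have "bij_betw (f \<circ> label P) {1..n} (atoms Q)"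
      using bij_betw_cong[of "{1..n}" "f \<circ> label P" "label Q"] Q.bij_label lab by simp
    then show ?thesis using P.bij_label bij_betw_comp_iff by blast
  qed
  ultimately show ?thesis unfolding lat_le_def using fc by blast
qed

text \<open>An order embedding that respects labels keeps every single support; surjectivity then
  identifies the two families.\<close>

lemma supports_eq_if_lat_iso:
  assumes "P \<in> labeled_atomic_lattices n" "Q \<in> labeled_atomic_lattices n" "lat_iso n Q P"
  shows "supports n Q = supports n P"
proof -
  interpret Q: labeled_atomic_lattice n Q using assms by (simp add: mem_labeled_atomic_lattices)
  obtain f where f: "bij_betw f (carrier Q) (carrier P)" "order_emb Q P f"
    and lab: "\<And>i. i \<in> {1..n} \<Longrightarrow> f (label Q i) = label P i"
    using assms(3) by (auto simp: lat_iso_def)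
  have "supp n P (f q) = supp n Q q" if "q \<in> carrier Q" for q
    using f(2) that lab Q.label_closed unfolding order_emb_def supp_def by (metis (no_types, lifting))
  then have "supp n Q ` carrier Q = supp n P ` f ` carrier Q"
    by (simp add: image_image)
  then show ?thesis using f(1) by (simp add: supports_def bij_betw_def)
qed

section \<open>Deleting a maximal element with missing support\<close>

theorem theorem4p3:
  fixes n :: nat and P Q :: "'a labeled_lattice"
  assumes "P \<in> labeled_atomic_lattices n"
    and "Q \<in> labeled_atomic_lattices n"
    and "lat_covers n P Q"
  shows "\<forall>T \<in> supports n P - supports n Q.
           \<forall>p \<in> carrier P. supp n P p = T \<longrightarrow> meet_irreducible P p"
proof (intro ballI impI)
  interpret P: labeled_atomic_lattice n P using assms by (simp add: mem_labeled_atomic_lattices)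
  interpret Q: labeled_atomic_lattice n Q using assms by (simp add: mem_labeled_atomic_lattices)
  fix T p assume "T \<in> supports n P - supports n Q" and p: "p \<in> carrier P" "supp n P p = T"
  then have pQ: "supp n P p \<notin> supports n Q" by simp
  let ?D = "{x \<in> carrier P. supp n P x \<notin> supports n Q}"
  have "finite (supp n P ` ?D)" "supp n P ` ?D \<noteq> {}"
    using P.finite_carrier p(1) pQ by auto
  \<comment> \<open>Maximality is taken among supports under inclusion; \<open>max\<close> carries
    it over to the order of \<open>P\<close>.\<close>
  from finite_has_maximal[OF this] obtain t
    where t: "t \<in> carrier P" "supp n P t \<notin> supports n Q"
      and t_max: "\<forall>S \<in> supp n P ` ?D. supp n P t \<subseteq> S \<longrightarrow> supp n P t = S"
    by auto
  have max: "supp n P x \<in> supports n Q" if "x \<in> carrier P" "t \<sqsubseteq>\<^bsub>P\<^esub> x" "x \<noteq> t" for x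
  proof (rule ccontr)
    assume "supp n P x \<notin> supports n Q"
    then have "supp n P t = supp n P x"
      using t_max that(1,2) t(1) P.supp_subset_iff[of t x] by simp
    then show False using P.supp_inj that(1,3) t(1) by (auto dest: inj_onD)
  qed
  \<comment> \<open>This serves twice: for closure of \<open>carrier P - {t}\<close> under meets,
    and for meet-irreducibility of \<open>p\<close> once \<open>p = t\<close> is known.\<close>
  have irr: "x \<sqinter>\<^bsub>P\<^esub> y \<noteq> t" if "x \<in> carrier P" "y \<in> carrier P" "x \<noteq> t" "y \<noteq> t" for x y
  proof
    assume "x \<sqinter>\<^bsub>P\<^esub> y = t"
    then have "t \<sqsubseteq>\<^bsub>P\<^esub> x" "t \<sqsubseteq>\<^bsub>P\<^esub> y" using that P.meet_left P.meet_right by blast+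
    then have "supp n P x \<inter> supp n P y \<in> supports n Q" using max that Q.supports_Int by simp
    then show False using t(2) P.supp_meet that \<open>x \<sqinter>\<^bsub>P\<^esub> y = t\<close> by metis
  qed
  define R where "R = P\<lparr>carrier := carrier P - {t}\<rparr>"
  have R: "R \<in> labeled_atomic_lattices n"
    unfolding R_def
  proof (rule P.meet_closed_suborder)
    show "\<bottom>\<^bsub>P\<^esub> \<in> carrier P - {t}"
      using t(2) P.supp_bottom Q.supports_bottom by auto
    show "\<top>\<^bsub>P\<^esub> \<in> carrier P - {t}"
      using t(2) P.supp_top Q.supports_top by auto
    show "atoms P \<subseteq> carrier P - {t}"
      using t(2) P.supp_label Q.supports_singleton P.label_closed by (auto simp: P.atoms_eq)
  qed (use irr in auto)
  \<comment> \<open>Labels and order are untouched, so supports of the remaining elements are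
    unchanged; injectivity of \<open>supp n P\<close> ensures that exactly one set is lost.\<close>
  have supp_R: "supports n R = supports n P - {supp n P t}"
  proof -
    have "supports n R = supp n P ` (carrier P - {t})"
      by (simp add: R_def supports_def supp_def)
    also have "\<dots> = supports n P - {supp n P t}"
      using inj_on_image_set_diff[OF P.supp_inj, of "carrier P" "{t}"] t(1)
      by (auto simp: supports_def)
    finally show ?thesis .
  qed
  have "supports n Q \<subseteq> supports n P"
    using assms supports_mono_if_lat_le by (auto simp: lat_covers_def lat_less_def)
  then have "lat_le n Q R" using lat_le_if_supports_mono[OF R assms(2)] supp_R t(2) by auto
  moreover have "lat_less n R P"
    unfolding lat_less_def
  proof
    show "lat_le n R P" using lat_le_if_supports_mono[OF assms(1) R] supp_R by auto
    show "\<not> lat_iso n R P"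
      using supports_eq_if_lat_iso[OF assms(1) R] supp_R t(1) by (auto simp: supports_def)
  qed
  \<comment> \<open>Otherwise \<open>R\<close> would lie strictly between \<open>Q\<close> and
    \<open>P\<close>.\<close>
  ultimately have "lat_iso n Q R" using assms(3) R by (auto simp: lat_covers_def lat_less_def)
  then have "supports n Q = supports n P - {supp n P t}"
    using supports_eq_if_lat_iso[OF R assms(2)] supp_R by simp
  \<comment> \<open>The support of \<open>p\<close> occurs in \<open>P\<close> but not in
    \<open>Q\<close>, so it is the one deleted set.\<close>
  then have "supp n P p = supp n P t" using pQ p(1) by (auto simp: supports_def)
  then have "p = t" using P.supp_inj p(1) t(1) by (auto dest: inj_onD)
  then show "meet_irreducible P p"
    unfolding meet_irreducible_def using t(1) irr P.lless_eq by metis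
qed

end
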